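(* Let $S=K[t_1,\ldots,t_s]$ be a polynomial ring over a field $K$, and let $I_1$ and $I_2$ be ideals of $S$ generated by monomials in disjoint sets of variables. The following hold. (a) $I_1I_2=I_1\cap I_2$. (b) $\overline{I_1}\ \overline{I_2}\subset\overline{I_1I_2}$. (c) $\overline{(I_1I_2)^n}=\overline{I_1^n}\ \overline{I_2^n}$ for all $n\geq 1$. (d) $I_1I_2$ is normal if and only if $I_1$ and $I_2$ are normal.
   Context: "Generated by monomials in disjoint sets of variables" means that there are disjoint subsets $X_1,X_2$ of $\{t_1,\ldots,t_s\}$ such that $I_i$ is generated by monomials in the variables of $X_i$ for $i=1,2$. For an ideal $J$ of $S$, $\overline{J}$ denotes its integral closure. An ideal $J$ is called normal if $J^n=\overline{J^n}$ for all integers $n\geq 1$.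
   Formalization: Part (d) is stated for nonzero ideals I_1 and I_2; with the zero ideal allowed it fails, e.g. I_1 = 0 and I_2 = (x^2, y^2), where the product 0 is normal but I_2 is not. *)

theory Defs
  imports Complex_Main "HOL-Library.Poly_Mapping"
begin

text \<open>The polynomial ring $K[t_1,\ldots,t_s]$: finitely supported coefficient functions on
  exponent vectors, the variables being the elements of the finite type \<open>'v\<close>, so
  $s$ is the cardinality of \<open>'v\<close>. The product is the library's convolution product.\<close>

type_synonym ('v, 'k) mpoly = "('v \<Rightarrow>\<^sub>0 nat) \<Rightarrow>\<^sub>0 'k"

text \<open>A commutative ring as a module over itself: \<open>ideal.subspace\<close> says that a set is an
  ideal, and \<open>ideal.span G\<close> is the ideal generated by \<open>G\<close>.\<close>

interpretation ideal: module "(*) :: 'a::comm_ring_1 \<Rightarrow> 'a \<Rightarrow> 'a"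
  by standard (simp_all add: algebra_simps)

definition monomials_in :: "'v set \<Rightarrow> ('v, 'k::field) mpoly set" where
  "monomials_in X = {Poly_Mapping.single e 1 | e. Poly_Mapping.keys e \<subseteq> X}"

definition generated_by_monomials_in :: "('v, 'k::field) mpoly set \<Rightarrow> 'v set \<Rightarrow> bool" where
  "generated_by_monomials_in I X \<longleftrightarrow> (\<exists>G \<subseteq> monomials_in X. I = ideal.span G)"

definition generated_by_monomials_in_disjoint_variables ::
    "('v, 'k::field) mpoly set \<Rightarrow> ('v, 'k) mpoly set \<Rightarrow> bool" where
  "generated_by_monomials_in_disjoint_variables I\<^sub>1 I\<^sub>2 \<longleftrightarrow>
     (\<exists>X\<^sub>1 X\<^sub>2. X\<^sub>1 \<inter> X\<^sub>2 = {} \<and> generated_by_monomials_in I\<^sub>1 X\<^sub>1 \<and> generated_by_monomials_in I\<^sub>2 X\<^sub>2)"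

definition ideal_prod :: "'a::comm_ring_1 set \<Rightarrow> 'a set \<Rightarrow> 'a set" where
  "ideal_prod I J = ideal.span {a * b | a b. a \<in> I \<and> b \<in> J}"

primrec ideal_pow :: "'a::comm_ring_1 set \<Rightarrow> nat \<Rightarrow> 'a set" where
  "ideal_pow I 0 = UNIV"
| "ideal_pow I (Suc n) = ideal_prod I (ideal_pow I n)"

text \<open>Elements $f$ with $f^m + a_1 f^{m-1} + \cdots + a_m = 0$ for some $m \geq 1$ and
  $a_i \in J^i$.\<close>

definition integral_closure :: "'a::comm_ring_1 set \<Rightarrow> 'a set" where
  "integral_closure J =
     {f. \<exists>m\<ge>1. \<exists>a. (\<forall>i\<in>{1..m}. a i \<in> ideal_pow J i) \<and>
           f ^ m + (\<Sum>i=1..m. a i * f ^ (m - i)) = 0}"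

definition normal_ideal :: "'a::comm_ring_1 set \<Rightarrow> bool" where
  "normal_ideal J \<longleftrightarrow> (\<forall>n\<ge>1. ideal_pow J n = integral_closure (ideal_pow J n))"

end

theory Submission
  imports Defs "HOL-Computational_Algebra.Polynomial" "HOL-Library.Set_Algebras"
begin

text \<open>
  Everything about monomial ideals can be read off from sets of exponent vectors. If \<open>U\<close> is the
  set of exponents of the generators of $I$, then a polynomial lies in $I^n$ iff each of its
  exponents lies in the $n$-fold sumset of \<open>U\<close>, enlarged by arbitrary vectors
  (\<open>n_fold U n\<close>). The heart of the proof is the corresponding description of the integral closure
  (\<open>integral_closure_monomial_span\<close>): a polynomial is integral over $I$ iff each exponent $a$
  in it satisfies \<open>m a \<in> n_fold U m\<close> for some $m \<ge> 1$. These $a$ form the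
  \<open>power_hull\<close> of \<open>U\<close>, the lattice points of its Newton polyhedron.

  That such polynomials are integral follows once the integral closure of an ideal is known to be
  an ideal. An element $f$ is integral over $I$ iff $f T$ is integral, in the usual sense, over
  the Rees algebra $\bigoplus I^n T^n$ inside the polynomial ring in $T$, so this reduces to the
  statement that sums of elements integral over a subring are integral. The latter is proved by
  eliminating the unknowns one by one from a linear system, which replaces the determinant.

  For the converse let $f$ be integral over $I$ and let $a$ be an exponent of $f$. Adding the other
  monomials of $f$ to the generators makes the single monomial $t^a$ integral, and for one monomial
  the equation of integral dependence says directly that $a$ lies in the power hull of \<open>U\<close>
  together with the other exponents of $f$. So no exponent of $f$ is an extreme point relative to
  \<open>U\<close>. The power hull has the anti-exchange property of convex hulls
  (\<open>power_hull_anti_exchange\<close>), and therefore all exponents lie in the power hull of \<open>U\<close> itself.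
  Only exponents are compared, so the argument is the same over every field.

  The theorem itself is then combinatorics. If the exponents in \<open>U\<close> only involve the variables
  in \<open>X\<close>, membership in \<open>n_fold U n\<close> and in its power hull depends only on the coordinates
  in \<open>X\<close>; such sets are called cylinders below. For cylinders over disjoint sets of variables
  sum and intersection coincide. This gives (a), and since $m a$ lies in an intersection iff it
  lies in both sets, it gives (c), of which (b) is the case $n = 1$. For (d), an exponent that
  violates normality of one factor comes to violate normality of the product when its coordinates
  outside the variables of that factor are replaced by those of an exponent in the corresponding
  power of the other factor; such an exponent exists because the other factor is not zero.
\<close>

(* The rule a * (b * c) = (a * b) * c is a simp rule of modules; here, where the ring acts on
   itself, it would loop together with mult.assoc. *)
declare ideal.scale_scale [simp del]

section \<open>Integral elements over a subring\<close>

text \<open>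
  Think of \<open>B d\<close> as the polynomials in \<open>x\<close> of degree below \<open>d\<close> with coefficients in a subring, so
  that the pivots \<open>p i\<close> are monic of degree \<open>d\<close> and every off-diagonal entry has smaller degree.
  Cross-multiplying to remove the unknown \<open>v n\<close> preserves this shape with \<open>2 d\<close> in place of \<open>d\<close>,
  because a product of two off-diagonal entries cannot reach the leading term of a product of
  pivots. After all eliminations a monic expression annihilates every \<open>v i\<close>.
\<close>
lemma eliminate_homogeneous_system:
  fixes B :: "nat \<Rightarrow> 'a::comm_ring_1 set"
  assumes B_zero: "\<And>d. 0 \<in> B d"
    and B_diff: "\<And>a b d. a \<in> B d \<Longrightarrow> b \<in> B d \<Longrightarrow> a - b \<in> B d"
    and B_mult: "\<And>a b d e. a \<in> B d \<Longrightarrow> b \<in> B e \<Longrightarrow> a * b \<in> B (d + e)"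
    and B_power: "\<And>b d e. b \<in> B e \<Longrightarrow> x ^ d * b \<in> B (d + e)"
  assumes "finite J"
    and "\<And>i. i \<in> J \<Longrightarrow> p i - x ^ d \<in> B d"
    and "\<And>i j. i \<in> J \<Longrightarrow> j \<in> J \<Longrightarrow> q i j \<in> B d"
    and "\<And>i. i \<in> J \<Longrightarrow> p i * v i = (\<Sum>j\<in>J - {i}. q i j * v j)"
  shows "\<exists>e P. P - x ^ e \<in> B e \<and> (\<forall>i\<in>J. P * v i = 0)"
  using assms(5-)
proof (induction J arbitrary: d p q rule: finite_induct)
  case empty
  show ?case using B_zero by (intro exI[of _ 0] exI[of _ 1]) simp
next
  case (insert n J)
  have B_add: "a + b \<in> B e" if "a \<in> B e" "b \<in> B e" for a b e
    using B_diff[OF that(1) B_diff[OF B_zero that(2)]] by simp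
  define p' where "p' i = p n * p i - q i n * q n i" for i
  define q' where "q' i j = p n * q i j + q i n * q n j" for i j
  have "p' i - x ^ (d + d) \<in> B (d + d)" if "i \<in> J" for i
  proof -
    have pn: "p n - x ^ d \<in> B d" and pi: "p i - x ^ d \<in> B d"
      and q: "q i n \<in> B d" "q n i \<in> B d" using insert.prems that by auto
    have eq: "p' i - x ^ (d + d) = ((p n - x ^ d) * (p i - x ^ d) + x ^ d * (p n - x ^ d)
            + x ^ d * (p i - x ^ d)) - q i n * q n i"
      by (simp add: p'_def power_add algebra_simps)
    show ?thesis unfolding eq by (intro B_diff B_add B_mult B_power pn pi q)
  qed
  moreover have "q' i j \<in> B (d + d)" if "i \<in> J" "j \<in> J" for i j
  proof -
    have pn: "p n - x ^ d \<in> B d"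
      and q: "q i n \<in> B d" "q n j \<in> B d" "q i j \<in> B d" using insert.prems that by auto
    have eq: "q' i j = (p n - x ^ d) * q i j + x ^ d * q i j + q i n * q n j"
      by (simp add: q'_def algebra_simps)
    show ?thesis unfolding eq by (intro B_add B_mult B_power pn q)
  qed
  moreover have "p' i * v i = (\<Sum>j\<in>J - {i}. q' i j * v j)" if "i \<in> J" for i
  proof -
    have "n \<noteq> i" using that insert.hyps by auto
    then have "insert n J - {i} = insert n (J - {i})" by auto
    with insert.prems(3)[of i] that insert.hyps
    have row_i: "p i * v i = q i n * v n + (\<Sum>j\<in>J - {i}. q i j * v j)" by simp
    have "p n * v n = (\<Sum>j\<in>J. q n j * v j)"
      using insert.prems(3)[of n] insert.hyps by simp
    then have row_n: "p n * v n = q n i * v i + (\<Sum>j\<in>J - {i}. q n j * v j)"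
      by (simp add: sum.remove[OF insert.hyps(1) that])
    have "p' i * v i = p n * (p i * v i) - q i n * (q n i * v i)"
      by (simp add: p'_def left_diff_distrib mult.assoc)
    also have "\<dots> = q i n * (p n * v n) + p n * (\<Sum>j\<in>J - {i}. q i j * v j) - q i n * (q n i * v i)"
      unfolding row_i by (simp add: distrib_left mult.left_commute)
    also have "\<dots> = p n * (\<Sum>j\<in>J - {i}. q i j * v j) + q i n * (\<Sum>j\<in>J - {i}. q n j * v j)"
      unfolding row_n by (simp add: distrib_left)
    also have "\<dots> = (\<Sum>j\<in>J - {i}. q' i j * v j)"
      by (simp add: q'_def sum_distrib_left distrib_right mult.assoc sum.distrib)
    finally show ?thesis .
  qed
  ultimately obtain e P where P: "P - x ^ e \<in> B e" "\<forall>i\<in>J. P * v i = 0"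
    using insert.IH[of p' "d + d" q'] by blast
  have pn: "p n - x ^ d \<in> B d" using insert.prems by auto
  have eq: "P * p n - x ^ (e + d) = (P - x ^ e) * (p n - x ^ d) + x ^ e * (p n - x ^ d) + x ^ d * (P - x ^ e)"
    by (simp add: power_add algebra_simps)
  have "P * p n - x ^ (e + d) \<in> B (e + d)"
    unfolding eq using B_power[OF P(1), of d]
    by (intro B_add B_mult[OF P(1) pn] B_power[OF pn]) (simp add: add.commute)
  \<comment> \<open>\<open>P\<close> kills every \<open>v i\<close> with \<open>i \<noteq> n\<close>, hence also the right-hand side of row \<open>n\<close>, which is \<open>p n * v n\<close>.\<close>
  moreover have "P * p n * v i = 0" if "i \<in> insert n J" for i
  proof (cases "i = n")
    case True
    have "p n * v n = (\<Sum>j\<in>J. q n j * v j)"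
      using insert.prems(3)[of n] insert.hyps by simp
    then have "P * p n * v n = (\<Sum>j\<in>J. q n j * (P * v j))"
      by (simp add: mult.assoc sum_distrib_left mult.left_commute)
    then show ?thesis using True P(2) by simp
  next
    case False
    then have "P * v i = 0" using that P(2) by auto
    then show ?thesis by (simp add: mult.commute[of P] mult.assoc)
  qed
  ultimately show ?case by blast
qed

definition linear_combinations :: "'a::comm_ring_1 set \<Rightarrow> 'i set \<Rightarrow> ('i \<Rightarrow> 'a) \<Rightarrow> 'a set" where
  "linear_combinations R J v = {\<Sum>j\<in>J. c j * v j | c. \<forall>j\<in>J. c j \<in> R}"

text \<open>A monic equation of degree \<open>m\<close>, solved for its leading term. Degree zero cannot occur, as the
  equation would say \<open>1 = 0\<close>.\<close>
definition integral_over :: "'a::comm_ring_1 set \<Rightarrow> 'a \<Rightarrow> bool" where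
  "integral_over R x \<longleftrightarrow> (\<exists>m. x ^ m \<in> linear_combinations R {..<m} (\<lambda>i. x ^ i))"

locale unital_subring =
  fixes R :: "'a::comm_ring_1 set"
  assumes one_closed: "1 \<in> R"
    and diff_closed: "a \<in> R \<Longrightarrow> b \<in> R \<Longrightarrow> a - b \<in> R"
    and mult_closed: "a \<in> R \<Longrightarrow> b \<in> R \<Longrightarrow> a * b \<in> R"
begin

lemma zero_closed: "0 \<in> R"
  using diff_closed[OF one_closed one_closed] by simp

lemma linear_combinations_zero: "0 \<in> linear_combinations R J v"
  unfolding linear_combinations_def using zero_closed by (auto intro!: exI[of _ "\<lambda>_. 0"])

lemma linear_combinations_diff:
  assumes "a \<in> linear_combinations R J v" "b \<in> linear_combinations R J v"
  shows "a - b \<in> linear_combinations R J v"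
proof -
  obtain c c' where "a = (\<Sum>j\<in>J. c j * v j)" "b = (\<Sum>j\<in>J. c' j * v j)" "\<forall>j\<in>J. c j \<in> R \<and> c' j \<in> R"
    using assms by (auto simp: linear_combinations_def)
  then show ?thesis
    by (auto simp: linear_combinations_def sum_subtractf left_diff_distrib diff_closed
        intro!: exI[of _ "\<lambda>j. c j - c' j"])
qed

lemma linear_combinations_add:
  assumes "a \<in> linear_combinations R J v" "b \<in> linear_combinations R J v"
  shows "a + b \<in> linear_combinations R J v"
  using linear_combinations_diff[OF assms(1)
      linear_combinations_diff[OF linear_combinations_zero assms(2)]] by simp

lemma linear_combinations_scale:
  assumes "r \<in> R" "a \<in> linear_combinations R J v"
  shows "r * a \<in> linear_combinations R J v"
proof -
  obtain c where "a = (\<Sum>j\<in>J. c j * v j)" "\<forall>j\<in>J. c j \<in> R"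
    using assms by (auto simp: linear_combinations_def)
  then have "r * a = (\<Sum>j\<in>J. (r * c j) * v j)" "\<forall>j\<in>J. r * c j \<in> R"
    using assms(1) by (simp_all add: sum_distrib_left mult.assoc mult_closed)
  then show ?thesis unfolding linear_combinations_def
    by (intro CollectI exI[of _ "\<lambda>j. r * c j"] conjI)
qed

lemma linear_combinations_sum:
  assumes "\<And>k. k \<in> K \<Longrightarrow> f k \<in> linear_combinations R J v"
  shows "sum f K \<in> linear_combinations R J v"
  using assms
  by (induction K rule: infinite_finite_induct)
    (auto intro: linear_combinations_zero linear_combinations_add)

lemma linear_combinations_base:
  assumes "finite J" "j \<in> J"
  shows "v j \<in> linear_combinations R J v"
proof -
  have "(\<Sum>i\<in>J. (if i = j then 1 else 0) * v i) = (\<Sum>i\<in>J. if i = j then v i else 0)"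
    by (rule sum.cong) auto
  also have "\<dots> = v j" using assms by (simp add: sum.delta')
  finally show ?thesis using zero_closed one_closed
    by (force simp: linear_combinations_def intro!: exI[of _ "\<lambda>i. if i = j then 1 else 0"])
qed

text \<open>A multiplier that maps the generators of one module into another module maps everything there;
  all stability arguments below are instances of this.\<close>
lemma linear_combinations_transfer:
  assumes "a \<in> linear_combinations R K w"
    and "\<And>k. k \<in> K \<Longrightarrow> s * w k \<in> linear_combinations R J v"
  shows "s * a \<in> linear_combinations R J v"
proof -
  obtain c where c: "a = (\<Sum>k\<in>K. c k * w k)" "\<forall>k\<in>K. c k \<in> R"
    using assms(1) by (auto simp: linear_combinations_def)
  have "s * a = (\<Sum>k\<in>K. c k * (s * w k))"
    by (simp add: c(1) sum_distrib_left mult.left_commute)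
  also have "\<dots> \<in> linear_combinations R J v"
    using c(2) assms(2) by (intro linear_combinations_sum linear_combinations_scale[of "c _"]) auto
  finally show ?thesis .
qed

text \<open>The module generated by the \<open>v j\<close> is stable under \<open>x\<close>, so multiplication by \<open>x\<close> is a matrix over
  \<open>R\<close>. Elimination yields a monic polynomial expression in \<open>x\<close> that annihilates the module, and
  this expression vanishes because the module contains \<open>1\<close>.\<close>
lemma integral_if_stable_module:
  assumes "finite J" and one: "1 \<in> linear_combinations R J v"
    and stable: "\<And>j. j \<in> J \<Longrightarrow> x * v j \<in> linear_combinations R J v"
  shows "integral_over R x"
proof -
  let ?B = "\<lambda>d. linear_combinations R {..<d} (\<lambda>i. x ^ i)"
  have B_base: "x ^ i \<in> ?B d" if "i < d" for i d
    using linear_combinations_base[of "{..<d}" i "\<lambda>i. x ^ i"] that by simp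
  have B_power: "x ^ d * b \<in> ?B (d + e)" if "b \<in> ?B e" for b d e
    by (rule linear_combinations_transfer[OF that]) (auto intro: B_base simp flip: power_add)
  have B_mult: "a * b \<in> ?B (d + e)" if a: "a \<in> ?B d" and b: "b \<in> ?B e" for a b d e
  proof (rule linear_combinations_transfer[OF b])
    fix k assume "k \<in> {..<e}"
    then have "x ^ k * a \<in> ?B (d + e)"
      by (intro linear_combinations_transfer[OF a]) (auto intro: B_base simp flip: power_add)
    then show "a * x ^ k \<in> ?B (d + e)" by (simp add: mult.commute)
  qed
  have R_B: "r \<in> ?B 1" if "r \<in> R" for r
    using linear_combinations_scale[OF that B_base[of 0 1]] by simp
  have "\<forall>i\<in>J. \<exists>c. x * v i = (\<Sum>j\<in>J. c j * v j) \<and> (\<forall>j\<in>J. c j \<in> R)"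
    using stable by (auto simp: linear_combinations_def)
  then obtain c where c: "\<And>i. i \<in> J \<Longrightarrow> x * v i = (\<Sum>j\<in>J. c i j * v j)"
    and cR: "\<And>i j. i \<in> J \<Longrightarrow> j \<in> J \<Longrightarrow> c i j \<in> R" by metis
  have "\<exists>e P. P - x ^ e \<in> ?B e \<and> (\<forall>i\<in>J. P * v i = 0)"
  proof (rule eliminate_homogeneous_system[where B = ?B and d = 1 and p = "\<lambda>i. x - c i i" and q = c])
    fix i assume "i \<in> J"
    then show "x - c i i - x ^ 1 \<in> ?B 1"
      using linear_combinations_diff[OF linear_combinations_zero R_B[OF cR]] by simp
    show "(x - c i i) * v i = (\<Sum>j\<in>J - {i}. c i j * v j)"
      using c[OF \<open>i \<in> J\<close>] by (simp add: left_diff_distrib sum.remove[OF \<open>finite J\<close> \<open>i \<in> J\<close>])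
  qed (use \<open>finite J\<close> cR R_B in \<open>auto intro: linear_combinations_zero linear_combinations_diff B_mult B_power\<close>)
  then obtain e P where P: "P - x ^ e \<in> ?B e" "\<And>i. i \<in> J \<Longrightarrow> P * v i = 0" by blast
  obtain u where "1 = (\<Sum>j\<in>J. u j * v j)" using one by (auto simp: linear_combinations_def)
  then have "P = P * (\<Sum>j\<in>J. u j * v j)" by simp
  also have "\<dots> = (\<Sum>j\<in>J. u j * (P * v j))"
    by (simp add: sum_distrib_left mult.left_commute)
  finally have "P = 0" using P(2) by simp
  then have "x ^ e \<in> ?B e" using linear_combinations_diff[OF linear_combinations_zero P(1)] by simp
  then show ?thesis by (auto simp: integral_over_def)
qed

text \<open>The products \<open>x ^ i * y ^ j\<close> with exponents below the degrees of the two monic equations generate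
  a module that is stable under both \<open>x\<close> and \<open>y\<close>.\<close>
lemma integral_over_add:
  assumes "integral_over R x" "integral_over R y"
  shows "integral_over R (x + y)"
proof -
  obtain m n where x: "x ^ m \<in> linear_combinations R {..<m} (\<lambda>i. x ^ i)"
    and y: "y ^ n \<in> linear_combinations R {..<n} (\<lambda>i. y ^ i)"
    using assms by (auto simp: integral_over_def)
  define J where "J = {..<m} \<times> {..<n}"
  define v where "v = (\<lambda>(i, j). x ^ i * y ^ j)"
  let ?M = "linear_combinations R J v"
  have fin: "finite J" by (simp add: J_def)
  have base: "x ^ i * y ^ j \<in> ?M" if "i < m" "j < n" for i j
    using linear_combinations_base[OF fin, of "(i, j)" v] that by (simp add: J_def v_def)
  have xM: "x ^ i * y ^ j \<in> ?M" if "i \<le> m" "j < n" for i j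
  proof (cases "i = m")
    case True
    have "y ^ j * x ^ m \<in> ?M"
      by (rule linear_combinations_transfer[OF x]) (use base that in \<open>auto simp: mult.commute\<close>)
    then show ?thesis using True by (simp add: mult.commute)
  qed (use base that in auto)
  have yM: "x ^ i * y ^ j \<in> ?M" if "i \<le> m" "j \<le> n" "i < m \<or> j < n" for i j
  proof (cases "j = n")
    case True
    have "x ^ i * y ^ n \<in> ?M"
      by (rule linear_combinations_transfer[OF y]) (use xM that in auto)
    then show ?thesis using True by simp
  qed (use xM that in auto)
  show ?thesis
  proof (rule integral_if_stable_module[OF fin])
    show "1 \<in> ?M"
    proof (cases "m = 0 \<or> n = 0")
      case True
      then have "(1::'a) = 0" using x y by (auto simp: linear_combinations_def)
      then show ?thesis by simp
    qed (use base[of 0 0] in simp)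
    fix k assume "k \<in> J"
    then obtain i j where k: "k = (i, j)" "i < m" "j < n" by (auto simp: J_def)
    have "(x + y) * v k = x ^ Suc i * y ^ j + x ^ i * y ^ Suc j"
      by (simp add: k v_def algebra_simps)
    also have "\<dots> \<in> ?M" using k by (intro linear_combinations_add yM) auto
    finally show "(x + y) * v k \<in> ?M" .
  qed
qed

end

section \<open>The integral closure of an ideal\<close>

lemma ideal_prod_subspace [simp]: "ideal.subspace (ideal_prod I J)"
  by (simp add: ideal_prod_def)

lemma ideal_pow_subspace [simp]: "ideal.subspace (ideal_pow I n)"
  by (cases n) auto

lemma ideal_prod_mult: "a \<in> I \<Longrightarrow> b \<in> J \<Longrightarrow> a * b \<in> ideal_prod I J"
  unfolding ideal_prod_def by (rule ideal.span_base) blast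

lemma ideal_prod_least:
  assumes "ideal.subspace M" "\<And>a b. a \<in> I \<Longrightarrow> b \<in> J \<Longrightarrow> a * b \<in> M"
  shows "ideal_prod I J \<subseteq> M"
  unfolding ideal_prod_def by (rule ideal.span_minimal) (use assms in auto)

lemma ideal_prod_mono: "I \<subseteq> I' \<Longrightarrow> J \<subseteq> J' \<Longrightarrow> ideal_prod I J \<subseteq> ideal_prod I' J'"
  by (rule ideal_prod_least) (auto intro: ideal_prod_mult)

lemma ideal_pow_mono: "I \<subseteq> J \<Longrightarrow> ideal_pow I n \<subseteq> ideal_pow J n"
  by (induction n) (simp_all add: ideal_prod_mono)

lemma integral_closure_mono: "I \<subseteq> J \<Longrightarrow> integral_closure I \<subseteq> integral_closure J"
  unfolding integral_closure_def using ideal_pow_mono[of I J] by blast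

lemma ideal_pow_mult:
  assumes "a \<in> ideal_pow I m" "b \<in> ideal_pow I n"
  shows "a * b \<in> ideal_pow I (m + n)"
  using assms
proof (induction m arbitrary: a)
  case 0
  then show ?case by (auto intro: ideal.subspace_scale)
next
  case (Suc m)
  let ?M = "{c. c * b \<in> ideal_pow I (Suc m + n)}"
  have "ideal.subspace ?M"
    unfolding ideal.subspace_def
    by (auto simp: distrib_right mult.assoc ideal.subspace_0
        intro: ideal.subspace_add ideal.subspace_scale)
  moreover have "c * d \<in> ?M" if "c \<in> I" "d \<in> ideal_pow I m" for c d
    using ideal_prod_mult[OF that(1) Suc.IH[OF that(2) Suc.prems(2)]] by (simp add: mult.assoc)
  ultimately have "ideal_prod I (ideal_pow I m) \<subseteq> ?M" by (rule ideal_prod_least)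
  then show ?case using Suc.prems(1) by auto
qed

text \<open>The subring $\bigoplus_n I^n T^n$ of the polynomial ring in one new variable $T$.\<close>
definition rees_algebra :: "'a::comm_ring_1 set \<Rightarrow> 'a poly set" where
  "rees_algebra I = {p. \<forall>i. coeff p i \<in> ideal_pow I i}"

lemma unital_subring_rees_algebra: "unital_subring (rees_algebra I)"
proof
  show "1 \<in> rees_algebra I"
    by (auto simp: rees_algebra_def coeff_1 ideal.subspace_0)
  fix p q assume pq: "p \<in> rees_algebra I" "q \<in> rees_algebra I"
  then show "p - q \<in> rees_algebra I"
    by (auto simp: rees_algebra_def intro: ideal.subspace_diff)
  show "p * q \<in> rees_algebra I"
    unfolding rees_algebra_def
  proof (intro CollectI allI)
    fix n
    have "coeff p i * coeff q (n - i) \<in> ideal_pow I n" if "i \<in> {..n}" for i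
      using ideal_pow_mult[of "coeff p i" I i "coeff q (n - i)" "n - i"] pq that
      by (auto simp: rees_algebra_def)
    then show "coeff (p * q) n \<in> ideal_pow I n"
      unfolding coeff_mult by (intro ideal.subspace_sum) simp_all
  qed
qed

text \<open>Since \<open>monom f 1\<close> is homogeneous of degree one in the new variable, only the coefficient of
  degree \<open>m\<close> matters in a monic equation of degree \<open>m\<close> for it. This coefficient is an equation of
  integral dependence of \<open>f\<close> on \<open>I\<close>.\<close>
lemma integral_closure_iff_rees:
  "f \<in> integral_closure I \<longleftrightarrow> integral_over (rees_algebra I) (monom f 1)"
proof
  assume "f \<in> integral_closure I"
  then obtain m a where a: "\<And>i. i \<in> {1..m} \<Longrightarrow> a i \<in> ideal_pow I i"
    and eq: "f ^ m + (\<Sum>i=1..m. a i * f ^ (m - i)) = 0"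
    unfolding integral_closure_def by blast
  define c where "c j = monom (- a (m - j)) (m - j)" for j
  have "c j \<in> rees_algebra I" if "j < m" for j
    using a[of "m - j"] that
    by (auto simp: rees_algebra_def c_def ideal.subspace_0 intro!: ideal.subspace_neg)
  moreover have "monom f 1 ^ m = (\<Sum>j<m. c j * monom f 1 ^ j)"
  proof -
    have "(\<Sum>j<m. c j * monom f 1 ^ j) = (\<Sum>j<m. monom (- a (m - j) * f ^ j) m)"
      by (rule sum.cong) (auto simp: c_def monom_power mult_monom)
    also have "\<dots> = monom (\<Sum>j<m. - a (m - j) * f ^ j) m" by (simp add: monom_sum)
    also have "(\<Sum>j<m. - a (m - j) * f ^ j) = - (\<Sum>i=1..m. a i * f ^ (m - i))"
      unfolding sum_negf[symmetric]
      by (rule sum.reindex_bij_witness[of _ "\<lambda>i. m - i" "\<lambda>j. m - j"]) auto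
    also have "\<dots> = f ^ m" using eq by (simp add: add_eq_0_iff)
    finally show ?thesis by (simp add: monom_power)
  qed
  ultimately show "integral_over (rees_algebra I) (monom f 1)"
    unfolding integral_over_def linear_combinations_def by (intro exI[of _ m]) auto
next
  assume "integral_over (rees_algebra I) (monom f 1)"
  then obtain m c where c: "\<And>j. j < m \<Longrightarrow> c j \<in> rees_algebra I"
    and eq: "monom f 1 ^ m = (\<Sum>j<m. c j * monom f 1 ^ j)"
    by (auto simp: integral_over_def linear_combinations_def)
  have "m \<noteq> 0" using eq by (intro notI) simp
  define a where "a i = - coeff (c (m - i)) i" for i
  have "a i \<in> ideal_pow I i" if "i \<in> {1..m}" for i
    using c[of "m - i"] that by (auto simp: a_def rees_algebra_def intro!: ideal.subspace_neg)
  moreover have "f ^ m + (\<Sum>i=1..m. a i * f ^ (m - i)) = 0"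
  proof -
    have "f ^ m = coeff (monom f 1 ^ m) m" by (simp add: monom_power)
    also have "\<dots> = (\<Sum>j<m. coeff (c j) (m - j) * f ^ j)"
      unfolding eq coeff_sum
      by (rule sum.cong) (auto simp: monom_power mult.commute[of "c _"] coeff_monom_mult mult.commute[of "f ^ _"])
    also have "\<dots> = - (\<Sum>i=1..m. a i * f ^ (m - i))"
      unfolding sum_negf[symmetric] a_def
      by (rule sum.reindex_bij_witness[of _ "\<lambda>i. m - i" "\<lambda>j. m - j"]) auto
    finally show ?thesis by simp
  qed
  ultimately show "f \<in> integral_closure I"
    using \<open>m \<noteq> 0\<close> unfolding integral_closure_def
    by (intro CollectI exI[of _ m] conjI exI[of _ a]) auto
qed

lemma mem_integral_closureI:
  assumes "m \<ge> 1" "f ^ m \<in> ideal_pow I m"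
  shows "f \<in> integral_closure I"
proof -
  have "(\<Sum>i=1..m. (if i = m then - (f ^ m) else 0) * f ^ (m - i))
      = (\<Sum>i=1..m. if i = m then - (f ^ m) else 0)"
    by (rule sum.cong) auto
  also have "\<dots> = - (f ^ m)" using assms(1) by simp
  finally show ?thesis
    unfolding integral_closure_def using assms
    by (auto intro!: exI[of _ m] exI[of _ "\<lambda>i. if i = m then - (f ^ m) else 0"]
        ideal.subspace_neg ideal.subspace_0)
qed

text \<open>Closure under addition is inherited from the Rees algebra. For a multiple \<open>s * f\<close> one scales the
  coefficients of an equation for \<open>f\<close> by powers of \<open>s\<close>.\<close>
theorem integral_closure_subspace: "ideal.subspace (integral_closure I)"
  unfolding ideal.subspace_def
proof (intro conjI ballI allI)
  show "0 \<in> integral_closure I"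
    by (rule mem_integral_closureI[of 1]) (auto simp: ideal.subspace_0)
  fix f g assume f: "f \<in> integral_closure I"
  then show "f + g \<in> integral_closure I" if "g \<in> integral_closure I"
    using unital_subring.integral_over_add[OF unital_subring_rees_algebra] that
    by (auto simp: integral_closure_iff_rees simp flip: add_monom)
  obtain m a where m: "m \<ge> 1" and a: "\<And>i. i \<in> {1..m} \<Longrightarrow> a i \<in> ideal_pow I i"
    and eq: "f ^ m + (\<Sum>i=1..m. a i * f ^ (m - i)) = 0"
    using f unfolding integral_closure_def by blast
  fix s
  have "(s * f) ^ m + (\<Sum>i=1..m. (s ^ i * a i) * (s * f) ^ (m - i))
      = s ^ m * (f ^ m + (\<Sum>i=1..m. a i * f ^ (m - i)))"
  proof -
    have "(s ^ i * a i) * (s * f) ^ (m - i) = s ^ m * (a i * f ^ (m - i))" if "i \<in> {1..m}" for i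
    proof -
      have "s ^ m = s ^ i * s ^ (m - i)" using that by (simp flip: power_add)
      then show ?thesis by (simp add: power_mult_distrib algebra_simps)
    qed
    then show ?thesis by (simp add: power_mult_distrib distrib_left sum_distrib_left)
  qed
  then show "s * f \<in> integral_closure I"
    unfolding integral_closure_def using m a eq
    by (auto intro!: exI[of _ m] exI[of _ "\<lambda>i. s ^ i * a i"] ideal.subspace_scale)
qed

section \<open>Sumset powers and the power hull\<close>

primrec nscale :: "nat \<Rightarrow> 'a::comm_monoid_add \<Rightarrow> 'a" where
  "nscale 0 a = 0"
| "nscale (Suc n) a = a + nscale n a"

lemma nscale_add: "nscale (m + n) a = nscale m a + nscale n a"
  by (induction m) (simp_all add: add.assoc)

lemma nscale_plus: "nscale n (a + b) = nscale n a + nscale n b"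
  by (induction n) (simp_all add: ac_simps)

lemma nscale_mult: "nscale (m * n) a = nscale m (nscale n a)"
  by (induction m) (simp_all add: nscale_add)

lemma lookup_nscale: "Poly_Mapping.lookup (nscale n a) v = n * Poly_Mapping.lookup (a :: _ \<Rightarrow>\<^sub>0 nat) v"
  by (induction n) (simp_all add: lookup_add)

text \<open>The exponents of the $n$-th power of the monomial ideal with generator exponents \<open>U\<close>. Starting
  with \<open>UNIV\<close>, as $I^0$ is the unit ideal, makes every \<open>n_fold U n\<close> closed under adding
  arbitrary vectors; in particular \<open>n_fold U 1\<close> is the exponent set of the ideal itself.\<close>
primrec n_fold :: "'a::comm_monoid_add set \<Rightarrow> nat \<Rightarrow> 'a set" where
  "n_fold U 0 = UNIV"
| "n_fold U (Suc n) = U + n_fold U n"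

definition upward_closed :: "'a::comm_monoid_add set \<Rightarrow> bool" where
  "upward_closed A \<longleftrightarrow> (\<forall>a\<in>A. \<forall>b. a + b \<in> A)"

lemma upward_closed_add: "upward_closed A \<Longrightarrow> a \<in> A \<Longrightarrow> a + b \<in> A"
  by (simp add: upward_closed_def)

lemma upward_closed_plus: "upward_closed B \<Longrightarrow> upward_closed (A + B)"
  by (fastforce simp: upward_closed_def set_plus_def add.assoc)

lemma upward_closed_n_fold: "upward_closed (n_fold U n)"
  by (induction n) (simp_all add: upward_closed_plus, simp add: upward_closed_def)

lemma UNIV_plus_upward_closed: "upward_closed A \<Longrightarrow> UNIV + A = A"
  by (force simp: upward_closed_def set_plus_def add.commute intro: exI[of _ 0])

lemma n_fold_add: "n_fold U (m + n) = n_fold U m + n_fold U n"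
  by (induction m) (simp_all add: UNIV_plus_upward_closed upward_closed_n_fold add.assoc)

lemma n_fold_addI: "a \<in> n_fold U m \<Longrightarrow> b \<in> n_fold U n \<Longrightarrow> a + b \<in> n_fold U (m + n)"
  by (simp add: n_fold_add set_plus_intro)

lemma n_fold_n_fold: "n_fold (n_fold U n) m = n_fold U (n * m)"
  by (induction m) (simp_all add: n_fold_add)

lemma n_fold_plus: "n_fold (U + V) n = n_fold U n + n_fold V n"
proof (induction n)
  case 0
  show ?case using UNIV_plus_upward_closed[of "UNIV :: 'a set"] by (simp add: upward_closed_def)
qed (simp add: ac_simps)

lemma n_fold_mono: "U \<subseteq> V \<Longrightarrow> n_fold U n \<subseteq> n_fold V n"
  by (induction n) (simp_all add: set_plus_mono2)

lemma subset_n_fold_1: "U \<subseteq> n_fold U 1"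
  by (force simp: set_plus_def intro: exI[of _ 0])

lemma nscale_n_fold: "a \<in> n_fold U n \<Longrightarrow> nscale k a \<in> n_fold U (k * n)"
  by (induction k) (simp_all add: n_fold_addI)

text \<open>Here \<open>k\<close> counts how many of the \<open>m\<close> summands are equal to \<open>a\<close>.\<close>
lemma n_fold_insertE:
  assumes "x \<in> n_fold (insert a V) m"
  obtains k v where "k \<le> m" "v \<in> n_fold V (m - k)" "x = nscale k a + v"
  using assms
proof (induction m arbitrary: x thesis)
  case 0
  then show ?case by (metis le_refl n_fold.simps(1) UNIV_I diff_zero nscale.simps(1) add_0)
next
  case (Suc m)
  then obtain u y where x: "x = u + y" "u \<in> insert a V" "y \<in> n_fold (insert a V) m"
    by (auto simp: set_plus_def)
  then obtain k v where y: "k \<le> m" "v \<in> n_fold V (m - k)" "y = nscale k a + v"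
    using Suc.IH by metis
  show ?case
  proof (cases "u = a")
    case True
    then show ?thesis using Suc.prems(1)[of "Suc k" v] x y by (simp add: add.assoc)
  next
    case False
    then have "u + v \<in> n_fold V (Suc m - k)"
      using x y by (simp add: Suc_diff_le set_plus_intro)
    then show ?thesis using Suc.prems(1)[of k "u + v"] x y by (simp add: ac_simps)
  qed
qed

text \<open>For exponent vectors, these are the lattice points of the Newton polyhedron of \<open>U\<close>. The integral
  multiples play the role of convex combinations with rational coefficients.\<close>
definition power_hull :: "'a::comm_monoid_add set \<Rightarrow> 'a set" where
  "power_hull U = {a. \<exists>m\<ge>1. nscale m a \<in> n_fold U m}"

lemma power_hullI: "m \<ge> 1 \<Longrightarrow> nscale m a \<in> n_fold U m \<Longrightarrow> a \<in> power_hull U"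
  by (auto simp: power_hull_def)

lemma power_hullE:
  assumes "a \<in> power_hull U"
  obtains m where "m \<ge> 1" "nscale m a \<in> n_fold U m"
  using assms by (auto simp: power_hull_def)

lemma power_hull_mono: "U \<subseteq> V \<Longrightarrow> power_hull U \<subseteq> power_hull V"
  using n_fold_mono[of U V] by (fastforce simp: power_hull_def)

lemma n_fold_1_subset_power_hull: "n_fold U 1 \<subseteq> power_hull U"
  using power_hullI[of 1 _ U] by auto

lemma upward_closed_power_hull: "upward_closed (power_hull U)"
  using upward_closed_n_fold[of U] by (fastforce simp: upward_closed_def power_hull_def nscale_plus)

text \<open>Substituting a relation for \<open>c\<close> into a relation for \<open>d\<close>, after taking multiples that make the
  number of occurrences of \<open>c\<close> divisible.\<close>
lemma power_hull_insert_absorb: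
  assumes c: "c \<in> power_hull V" and d: "d \<in> power_hull (insert c V)"
  shows "d \<in> power_hull V"
proof -
  obtain M where M: "M \<ge> 1" "nscale M c \<in> n_fold V M" using c by (rule power_hullE)
  obtain N where N: "N \<ge> 1" "nscale N d \<in> n_fold (insert c V) N" using d by (rule power_hullE)
  obtain l v where v: "l \<le> N" "v \<in> n_fold V (N - l)" "nscale N d = nscale l c + v"
    using N(2) by (rule n_fold_insertE)
  have "nscale (M * N) d = nscale l (nscale M c) + nscale M v"
    by (simp add: nscale_mult v(3) nscale_plus) (metis mult.commute nscale_mult)
  also have "\<dots> \<in> n_fold V (l * M + M * (N - l))"
    by (intro n_fold_addI nscale_n_fold M v)
  also have "l * M + M * (N - l) = M * N"
    using v(1) by (metis add_mult_distrib2 le_add_diff_inverse mult.commute)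
  finally show ?thesis using M N by (intro power_hullI[of "M * N"]) auto
qed

lemma power_hull_Un_absorb:
  assumes "finite C" "C \<subseteq> power_hull U"
  shows "power_hull (U \<union> C) \<subseteq> power_hull U"
  using assms
proof (induction C rule: finite_induct)
  case (insert c C)
  then have "c \<in> power_hull (U \<union> C)" using power_hull_mono[of U "U \<union> C"] by auto
  then show ?case using power_hull_insert_absorb[of c "U \<union> C"] insert by auto
qed simp

text \<open>
  The hypotheses say that some multiple of \<open>a\<close> is \<open>k d\<close> plus a remainder, and some multiple of \<open>d\<close> is
  \<open>l a\<close> plus a remainder. Substituting one into the other and cancelling \<open>k l\<close> copies of \<open>a\<close> leaves
  a relation for \<open>a\<close> over \<open>V\<close>, unless nothing is left. In that case \<open>k\<close> and \<open>l\<close> are as large as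
  possible, so \<open>a\<close> and \<open>d\<close> dominate each other coordinatewise and are equal.
\<close>
lemma power_hull_anti_exchange:
  fixes a d :: "'v \<Rightarrow>\<^sub>0 nat"
  assumes a: "a \<in> power_hull (insert d V)" and d: "d \<in> power_hull (insert a V)" and "a \<noteq> d"
  shows "a \<in> power_hull V"
proof -
  obtain M where M: "M \<ge> 1" "nscale M a \<in> n_fold (insert d V) M" using a by (rule power_hullE)
  obtain N where N: "N \<ge> 1" "nscale N d \<in> n_fold (insert a V) N" using d by (rule power_hullE)
  obtain k v where v: "k \<le> M" "v \<in> n_fold V (M - k)" "nscale M a = nscale k d + v"
    using M(2) by (rule n_fold_insertE)
  obtain l w where w: "l \<le> N" "w \<in> n_fold V (N - l)" "nscale N d = nscale l a + w"
    using N(2) by (rule n_fold_insertE)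
  have "nscale (N * M) a = nscale (k * l) a + (nscale k w + nscale N v)"
  proof -
    have "nscale (N * M) a = nscale N (nscale k d) + nscale N v"
      by (simp add: nscale_mult v(3) nscale_plus)
    also have "nscale N (nscale k d) = nscale k (nscale l a + w)"
      by (metis mult.commute nscale_mult w(3))
    finally show ?thesis by (simp add: nscale_plus nscale_mult add.assoc)
  qed
  moreover have kl: "k * l \<le> N * M" using v(1) w(1) by (metis mult.commute mult_le_mono)
  then have "nscale (N * M) a = nscale (k * l) a + nscale (N * M - k * l) a"
    by (metis le_add_diff_inverse nscale_add)
  ultimately have eq: "nscale (N * M - k * l) a = nscale k w + nscale N v" by simp
  have "k * (N - l) + N * (M - k) = N * M - k * l"
  proof -
    have "k * (N - l) = k * N - k * l" "N * (M - k) = N * M - N * k"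
      by (simp_all add: diff_mult_distrib2)
    moreover have "k * l \<le> k * N" "N * k \<le> N * M" using v(1) w(1) by simp_all
    ultimately show ?thesis by (simp add: mult.commute)
  qed
  moreover have "nscale k w + nscale N v \<in> n_fold V (k * (N - l) + N * (M - k))"
    by (intro n_fold_addI nscale_n_fold v w)
  ultimately have mem: "nscale (N * M - k * l) a \<in> n_fold V (N * M - k * l)"
    by (simp add: eq)
  have "N * M - k * l \<ge> 1"
  proof (rule ccontr)
    assume "\<not> N * M - k * l \<ge> 1"
    then have "k * l = N * M" using kl by simp
    then have "k = M" "l = N"
    proof -
      have "k * l \<le> k * N" "k * N \<le> M * N" "k * l \<le> M * l" "M * l \<le> M * N"
        using v(1) w(1) by simp_all
      moreover have "k * l = M * N" using \<open>k * l = N * M\<close> by (simp add: mult.commute)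
      ultimately have "k * N = M * N" "M * l = M * N" by linarith+
      then show "k = M" "l = N" using M(1) N(1) by simp_all
    qed
    have "M * Poly_Mapping.lookup a x = M * Poly_Mapping.lookup d x + Poly_Mapping.lookup v x" for x
      using v(3) \<open>k = M\<close> by (metis lookup_add lookup_nscale)
    moreover have "N * Poly_Mapping.lookup d x = N * Poly_Mapping.lookup a x + Poly_Mapping.lookup w x" for x
      using w(3) \<open>l = N\<close> by (metis lookup_add lookup_nscale)
    ultimately have "M * Poly_Mapping.lookup d x \<le> M * Poly_Mapping.lookup a x" "N * Poly_Mapping.lookup a x \<le> N * Poly_Mapping.lookup d x" for x
      by (metis le_add1)+
    then have "Poly_Mapping.lookup a x = Poly_Mapping.lookup d x" for x
      using M(1) N(1) by (simp add: le_antisym)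
    then show False using \<open>a \<noteq> d\<close> by (simp add: poly_mapping_eqI)
  qed
  then show ?thesis using mem by (rule power_hullI)
qed

text \<open>By anti-exchange, deleting a point \<open>d\<close> from \<open>C\<close> preserves the hypothesis for the remaining points, so
  these lie in the hull of \<open>U\<close> by induction. Then \<open>d\<close> lies in a hull generated by \<open>U\<close> and points
  of its hull, which adds nothing.\<close>
lemma subset_power_hull_if_no_extreme_point:
  fixes C :: "('v \<Rightarrow>\<^sub>0 nat) set"
  assumes "finite C" "\<And>a. a \<in> C \<Longrightarrow> a \<in> power_hull (U \<union> (C - {a}))"
  shows "C \<subseteq> power_hull U"
  using assms
proof (induction C rule: finite_induct)
  case (insert d C)
  have d: "d \<in> power_hull (U \<union> C)" using insert.prems[of d] insert.hyps by simp
  have "C \<subseteq> power_hull U"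
  proof (rule insert.IH)
    fix a assume "a \<in> C"
    let ?V = "U \<union> (C - {a})"
    have "a \<noteq> d" using \<open>a \<in> C\<close> insert.hyps by auto
    then have "U \<union> (insert d C - {a}) = insert d ?V" "U \<union> C = insert a ?V"
      using \<open>a \<in> C\<close> by auto
    then show "a \<in> power_hull ?V"
      using power_hull_anti_exchange[of a d ?V] insert.prems[of a] d \<open>a \<in> C\<close> \<open>a \<noteq> d\<close> by simp
  qed
  then show ?case using d power_hull_Un_absorb[OF insert.hyps(1)] by auto
qed simp

section \<open>Monomial ideals\<close>

definition monomial_span :: "('v \<Rightarrow>\<^sub>0 nat) set \<Rightarrow> ('v, 'k::field) mpoly set" where
  "monomial_span A = {f. Poly_Mapping.keys f \<subseteq> A}"

lemma monomial_span_subspace: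
  assumes "upward_closed A"
  shows "ideal.subspace (monomial_span A :: ('v, 'k::field) mpoly set)"
  unfolding ideal.subspace_def monomial_span_def
proof (intro conjI ballI allI)
  fix f g :: "('v, 'k) mpoly"
  assume f: "f \<in> {f. Poly_Mapping.keys f \<subseteq> A}"
  then show "f + g \<in> {f. Poly_Mapping.keys f \<subseteq> A}" if "g \<in> {f. Poly_Mapping.keys f \<subseteq> A}"
    using that keys_add[of f g] by auto
  fix s :: "('v, 'k) mpoly"
  have "b + a \<in> A" if "a \<in> Poly_Mapping.keys f" for a b
    using f that upward_closed_add[OF assms, of a b] by (auto simp: add.commute)
  then show "s * f \<in> {f. Poly_Mapping.keys f \<subseteq> A}" using keys_mult[of s f] by auto
qed simp

lemma single_mem_monomial_span [simp]: "Poly_Mapping.single a 1 \<in> monomial_span A \<longleftrightarrow> a \<in> A"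
  by (simp add: monomial_span_def)

lemma monomial_span_inject:
  "(monomial_span A :: ('v, 'k::field) mpoly set) = monomial_span B \<longleftrightarrow> A = B"
proof
  assume eq: "(monomial_span A :: ('v, 'k) mpoly set) = monomial_span B"
  have "a \<in> A \<longleftrightarrow> a \<in> B" for a
    using single_mem_monomial_span[of a A, where ?'b = 'k] single_mem_monomial_span[of a B, where ?'b = 'k]
    unfolding eq by simp
  then show "A = B" by blast
qed simp

lemma sum_of_terms: "f = (\<Sum>a\<in>Poly_Mapping.keys f. Poly_Mapping.single a (Poly_Mapping.lookup f a))"
proof (rule poly_mapping_eqI)
  fix b
  have "Poly_Mapping.lookup (\<Sum>a\<in>Poly_Mapping.keys f. Poly_Mapping.single a (Poly_Mapping.lookup f a)) b
      = (\<Sum>a\<in>Poly_Mapping.keys f. if a = b then Poly_Mapping.lookup f a else 0)"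
    unfolding lookup_sum by (rule sum.cong) (auto simp: lookup_single when_def)
  then show "Poly_Mapping.lookup f b = Poly_Mapping.lookup (\<Sum>a\<in>Poly_Mapping.keys f. Poly_Mapping.single a (Poly_Mapping.lookup f a)) b"
    by (simp add: in_keys_iff)
qed

lemma monomial_span_least:
  fixes M :: "('v, 'k::field) mpoly set"
  assumes M: "ideal.subspace M" and "\<And>a. a \<in> A \<Longrightarrow> Poly_Mapping.single a 1 \<in> M"
  shows "monomial_span A \<subseteq> M"
proof
  fix f :: "('v, 'k) mpoly" assume f: "f \<in> monomial_span A"
  have "Poly_Mapping.single a (Poly_Mapping.lookup f a) \<in> M" if "a \<in> Poly_Mapping.keys f" for a
  proof -
    have "Poly_Mapping.single 0 (Poly_Mapping.lookup f a) * Poly_Mapping.single a 1 \<in> M"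
      using f that assms by (auto simp: monomial_span_def intro!: ideal.subspace_scale[OF M])
    then show ?thesis by (simp add: mult_single)
  qed
  then show "f \<in> M" by (subst sum_of_terms) (rule ideal.subspace_sum[OF M])
qed

lemma span_monomials:
  "ideal.span ((\<lambda>u. Poly_Mapping.single u 1) ` U) = monomial_span (n_fold U 1)"
proof
  show "ideal.span ((\<lambda>u. Poly_Mapping.single u 1) ` U) \<subseteq> monomial_span (n_fold U 1)"
    using subset_n_fold_1[of U]
    by (intro ideal.span_minimal monomial_span_subspace upward_closed_n_fold) auto
  show "monomial_span (n_fold U 1) \<subseteq> ideal.span ((\<lambda>u. Poly_Mapping.single u 1) ` U)"
  proof (rule monomial_span_least)
    fix a assume "a \<in> n_fold U 1"
    then obtain u b where a: "a = u + b" "u \<in> U" by (auto simp: set_plus_def)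
    have "Poly_Mapping.single b 1 * Poly_Mapping.single u 1
        \<in> ideal.span ((\<lambda>u. Poly_Mapping.single u 1) ` U)"
      using a by (intro ideal.span_scale ideal.span_base) auto
    then show "Poly_Mapping.single a 1 \<in> ideal.span ((\<lambda>u. Poly_Mapping.single u 1) ` U)"
      by (simp add: mult_single a add.commute)
  qed simp
qed

lemma ideal_prod_monomial_span:
  assumes "upward_closed B"
  shows "ideal_prod (monomial_span A) (monomial_span B) = monomial_span (A + B)"
proof
  have "f * g \<in> monomial_span (A + B)" if "f \<in> monomial_span A" "g \<in> monomial_span B" for f g
    using keys_mult[of f g] that by (fastforce simp: monomial_span_def set_plus_def)
  then show "ideal_prod (monomial_span A) (monomial_span B) \<subseteq> monomial_span (A + B)"
    using assms by (intro ideal_prod_least monomial_span_subspace upward_closed_plus) auto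
  show "monomial_span (A + B) \<subseteq> ideal_prod (monomial_span A) (monomial_span B)"
  proof (rule monomial_span_least)
    fix c assume "c \<in> A + B"
    then obtain a b where c: "c = a + b" "a \<in> A" "b \<in> B" by (auto simp: set_plus_def)
    have "Poly_Mapping.single a 1 * Poly_Mapping.single b 1
        \<in> ideal_prod (monomial_span A) (monomial_span B)"
      using c by (intro ideal_prod_mult) auto
    then show "Poly_Mapping.single c 1 \<in> ideal_prod (monomial_span A) (monomial_span B)"
      by (simp add: mult_single c)
  qed simp
qed

lemma ideal_pow_monomial_span:
  "ideal_pow (monomial_span (n_fold U 1)) n = monomial_span (n_fold U n)"
proof (induction n)
  case 0
  show ?case by (simp add: monomial_span_def)
next
  case (Suc n)
  then show ?case
    using n_fold_add[of U 1 n] by (simp add: ideal_prod_monomial_span upward_closed_n_fold del: n_fold.simps)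
qed

lemma single_power: "Poly_Mapping.single a c ^ m = Poly_Mapping.single (nscale m a) (c ^ m)"
  by (induction m) (simp_all add: mult_single)

text \<open>The coefficient of $t^{m a}$ in the equation of integral dependence is $1$ in the leading term, so
  this monomial also occurs in some $c_i t^{(m-i)a}$ with $i \<ge> 1$. Hence $t^{i a}$ occurs in
  $c_i$, an element of $I^i$.\<close>
lemma monomial_in_integral_closure:
  assumes "Poly_Mapping.single a 1 \<in> integral_closure (monomial_span (n_fold U 1) :: ('v, 'k::field) mpoly set)"
  shows "a \<in> power_hull U"
proof -
  let ?x = "Poly_Mapping.single a 1 :: ('v, 'k) mpoly"
  obtain m c where c: "\<And>i. i \<in> {1..m} \<Longrightarrow> c i \<in> monomial_span (n_fold U i)"
    and eq: "?x ^ m + (\<Sum>i=1..m. c i * ?x ^ (m - i)) = 0"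
    using assms unfolding integral_closure_def ideal_pow_monomial_span by blast
  have "Poly_Mapping.lookup (?x ^ m) (nscale m a) + (\<Sum>i=1..m. Poly_Mapping.lookup (c i * ?x ^ (m - i)) (nscale m a)) = 0"
    using arg_cong[OF eq, of "\<lambda>f. Poly_Mapping.lookup f (nscale m a)"]
    by (simp only: lookup_add lookup_sum lookup_zero)
  then have "(\<Sum>i=1..m. Poly_Mapping.lookup (c i * ?x ^ (m - i)) (nscale m a)) \<noteq> 0"
    by (auto simp: single_power)
  then obtain i where i: "i \<in> {1..m}" "Poly_Mapping.lookup (c i * ?x ^ (m - i)) (nscale m a) \<noteq> 0"
    by (meson sum.neutral)
  then have "nscale m a \<in> Poly_Mapping.keys (c i * Poly_Mapping.single (nscale (m - i) a) 1)"
    by (simp add: in_keys_iff single_power)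
  then obtain b where b: "b \<in> Poly_Mapping.keys (c i)" "nscale m a = b + nscale (m - i) a"
    using keys_mult[of "c i" "Poly_Mapping.single (nscale (m - i) a) 1"] by auto
  moreover have "nscale m a = nscale i a + nscale (m - i) a"
    using i(1) by (simp flip: nscale_add)
  ultimately have "nscale i a \<in> n_fold U i" using c[OF i(1)] by (auto simp: monomial_span_def)
  then show ?thesis using i(1) by (intro power_hullI[of i]) auto
qed

text \<open>For the inclusion from left to right, each monomial of \<open>f\<close> is isolated by enlarging the ideal by all
  the other monomials of \<open>f\<close>: over the larger ideal, \<open>f\<close> and the rest of \<open>f\<close> are both integral, and
  so is their difference. The resulting conditions on the exponents are combined by
  \<open>subset_power_hull_if_no_extreme_point\<close>.\<close>
theorem integral_closure_monomial_span:
  "integral_closure (monomial_span (n_fold U 1) :: ('v, 'k::field) mpoly set) = monomial_span (power_hull U)"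
proof
  show "monomial_span (power_hull U) \<subseteq> integral_closure (monomial_span (n_fold U 1) :: ('v, 'k) mpoly set)"
  proof (rule monomial_span_least[OF integral_closure_subspace])
    fix a assume "a \<in> power_hull U"
    then obtain m where "m \<ge> 1" "nscale m a \<in> n_fold U m" by (rule power_hullE)
    then show "Poly_Mapping.single a 1 \<in> integral_closure (monomial_span (n_fold U 1) :: ('v, 'k) mpoly set)"
      by (intro mem_integral_closureI[of m]) (simp_all add: ideal_pow_monomial_span single_power del: One_nat_def)
  qed
  show "integral_closure (monomial_span (n_fold U 1)) \<subseteq> (monomial_span (power_hull U) :: ('v, 'k) mpoly set)"
  proof
    fix f :: "('v, 'k) mpoly" assume f: "f \<in> integral_closure (monomial_span (n_fold U 1))"
    have "a \<in> power_hull (U \<union> (Poly_Mapping.keys f - {a}))" if a: "a \<in> Poly_Mapping.keys f" for a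
    proof (rule monomial_in_integral_closure)
      let ?I = "monomial_span (n_fold (U \<union> (Poly_Mapping.keys f - {a})) 1) :: ('v, 'k) mpoly set"
      let ?c = "Poly_Mapping.lookup f a"
      have "f - Poly_Mapping.single a ?c \<in> ?I"
        using subset_n_fold_1[of "U \<union> (Poly_Mapping.keys f - {a})"]
        by (auto simp: monomial_span_def in_keys_iff lookup_minus lookup_single when_def split: if_splits simp del: One_nat_def)
      then have "f - Poly_Mapping.single a ?c \<in> integral_closure ?I"
        by (intro mem_integral_closureI[of 1]) (simp_all only: ideal_pow_monomial_span power_one_right)
      moreover have "f \<in> integral_closure ?I"
        using f integral_closure_mono[of "monomial_span (n_fold U 1)" ?I]
          n_fold_mono[of U "U \<union> (Poly_Mapping.keys f - {a})" 1] by (auto simp: monomial_span_def simp del: One_nat_def n_fold.simps)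
      ultimately have "Poly_Mapping.single a ?c \<in> integral_closure ?I"
        using ideal.subspace_diff[OF integral_closure_subspace, of f _ "f - Poly_Mapping.single a ?c"] by simp
      then have "Poly_Mapping.single 0 (1 / ?c) * Poly_Mapping.single a ?c \<in> integral_closure ?I"
        by (rule ideal.subspace_scale[OF integral_closure_subspace])
      then show "Poly_Mapping.single a 1 \<in> integral_closure ?I"
        using a by (simp add: mult_single in_keys_iff)
    qed
    then show "f \<in> monomial_span (power_hull U)"
      unfolding monomial_span_def by (intro CollectI subset_power_hull_if_no_extreme_point) auto
  qed
qed

lemma integral_closure_ideal_pow_monomial_span:
  "integral_closure (ideal_pow (monomial_span (n_fold U 1) :: ('v, 'k::field) mpoly set) n)
    = monomial_span (power_hull (n_fold U n))"
  using integral_closure_monomial_span[of "n_fold U n", where ?'k = 'k]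
  by (simp only: ideal_pow_monomial_span n_fold_n_fold mult_1_right)
lemma normal_monomial_ideal_iff:
  "normal_ideal (monomial_span (n_fold U 1) :: ('v, 'k::field) mpoly set)
    \<longleftrightarrow> (\<forall>n\<ge>1. n_fold U n = power_hull (n_fold U n))"
  unfolding normal_ideal_def integral_closure_ideal_pow_monomial_span
  by (simp only: ideal_pow_monomial_span monomial_span_inject)

section \<open>Exponent sets determined by disjoint sets of variables\<close>

text \<open>Membership of \<open>b\<close> in a cylinder depends only on the coordinates in \<open>X\<close>: those outside may be increased
  because the set is upward closed, and decreased by the second condition.\<close>
definition cylinder :: "'v set \<Rightarrow> ('v \<Rightarrow>\<^sub>0 nat) set \<Rightarrow> bool" where
  "cylinder X A \<longleftrightarrow> upward_closed A \<and> (\<forall>b c. Poly_Mapping.keys c \<inter> X = {} \<longrightarrow> b + c \<in> A \<longrightarrow> b \<in> A)"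

lemma cylinder_cancel: "cylinder X A \<Longrightarrow> b + c \<in> A \<Longrightarrow> Poly_Mapping.keys c \<inter> X = {} \<Longrightarrow> b \<in> A"
  by (auto simp: cylinder_def)

lemma cylinder_add: "cylinder X A \<Longrightarrow> b \<in> A \<Longrightarrow> b + c \<in> A"
  by (auto simp: cylinder_def upward_closed_def)

lemma split_exponent:
  fixes a :: "'v \<Rightarrow>\<^sub>0 nat"
  obtains b c where "a = b + c" "Poly_Mapping.keys b \<subseteq> X" "Poly_Mapping.keys c \<inter> X = {}"
proof -
  define b where "b = Abs_poly_mapping (\<lambda>v. if v \<in> X then Poly_Mapping.lookup a v else 0)"
  have "finite {v. (if v \<in> X then Poly_Mapping.lookup a v else 0) \<noteq> 0}"
    by (rule finite_subset[OF _ finite_keys[of a]]) (auto simp: in_keys_iff)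
  then have b: "Poly_Mapping.lookup b v = (if v \<in> X then Poly_Mapping.lookup a v else 0)" for v
    by (simp add: b_def)
  show ?thesis
  proof (rule that[of b "a - b"])
    show "a = b + (a - b)" by (rule poly_mapping_eqI) (simp add: lookup_add lookup_minus b)
  qed (auto simp: in_keys_iff lookup_minus b split: if_splits)
qed

text \<open>A summand \<open>u\<close> from \<open>U\<close> has no coordinates outside \<open>X\<close>, so it already fits below the part \<open>b\<close> and can
  be subtracted from it.\<close>
lemma cylinder_n_fold:
  fixes U :: "('v \<Rightarrow>\<^sub>0 nat) set"
  assumes "\<And>u. u \<in> U \<Longrightarrow> Poly_Mapping.keys u \<subseteq> X"
  shows "cylinder X (n_fold U n)"
proof -
  have "b \<in> n_fold U n" if "b + c \<in> n_fold U n" "Poly_Mapping.keys c \<inter> X = {}" for b c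
    using that
  proof (induction n arbitrary: b)
    case (Suc n)
    then obtain u a where u: "b + c = u + a" "u \<in> U" "a \<in> n_fold U n"
      by (auto simp: set_plus_def)
    have eq: "Poly_Mapping.lookup b v + Poly_Mapping.lookup c v = Poly_Mapping.lookup u v + Poly_Mapping.lookup a v" for v
      using u(1) by (metis lookup_add)
    have le: "Poly_Mapping.lookup u v \<le> Poly_Mapping.lookup b v" for v
    proof (cases "v \<in> X")
      case True
      then have "Poly_Mapping.lookup c v = 0" using Suc.prems(2) by (auto simp: in_keys_iff)
      then show ?thesis using eq[of v] by simp
    next
      case False
      then have "Poly_Mapping.lookup u v = 0" using assms[OF u(2)] by (auto simp: in_keys_iff)
      then show ?thesis by simp
    qed
    have b: "b = u + (b - u)"
      by (rule poly_mapping_eqI) (use le in \<open>simp add: lookup_add lookup_minus\<close>)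
    then have "u + (b - u + c) = u + a" using u(1) by (metis add.assoc)
    then have "b - u \<in> n_fold U n" using Suc.IH[of "b - u"] Suc.prems(2) u(3) by simp
    then show ?case using u(2) b by (metis n_fold.simps(2) set_plus_intro)
  qed simp
  then show ?thesis by (auto simp: cylinder_def upward_closed_n_fold)
qed

lemma keys_nscale_subset: "Poly_Mapping.keys (nscale m c :: 'v \<Rightarrow>\<^sub>0 nat) \<subseteq> Poly_Mapping.keys c"
  by (auto simp: in_keys_iff lookup_nscale)

lemma cylinder_power_hull:
  assumes "\<And>m. cylinder X (n_fold U m)"
  shows "cylinder X (power_hull U)"
  unfolding cylinder_def
proof (intro conjI allI impI)
  fix b c assume c: "Poly_Mapping.keys c \<inter> X = {}" and "b + c \<in> power_hull U"
  then obtain m where m: "m \<ge> 1" "nscale m b + nscale m c \<in> n_fold U m"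
    by (auto elim: power_hullE simp: nscale_plus)
  then have "nscale m b \<in> n_fold U m"
    using cylinder_cancel[OF assms] c keys_nscale_subset[of m c] by blast
  then show "b \<in> power_hull U" using m by (intro power_hullI)
qed (rule upward_closed_power_hull)

text \<open>A common element is split into its part in \<open>X\<close>, which suffices for membership in \<open>A\<close>, and its part
  outside \<open>X\<close>, which contains all coordinates relevant for \<open>B\<close>.\<close>
lemma cylinder_plus_eq_Int:
  assumes A: "cylinder X A" and B: "cylinder Y B" and "X \<inter> Y = {}"
  shows "A + B = A \<inter> B"
proof
  show "A + B \<subseteq> A \<inter> B"
  proof
    fix c assume "c \<in> A + B"
    then obtain a b where "c = a + b" "a \<in> A" "b \<in> B" by (rule set_plus_elim)
    then show "c \<in> A \<inter> B"
      using cylinder_add[OF A, of a b] cylinder_add[OF B, of b a] by (simp add: add.commute)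
  qed
  show "A \<inter> B \<subseteq> A + B"
  proof
    fix a assume a: "a \<in> A \<inter> B"
    obtain b c where bc: "a = b + c" "Poly_Mapping.keys b \<subseteq> X" "Poly_Mapping.keys c \<inter> X = {}" by (rule split_exponent)
    have "b \<in> A" using cylinder_cancel[OF A, of b c] a bc by simp
    moreover have "c \<in> B"
      using cylinder_cancel[OF B, of c b] a bc assms(3) by (auto simp: add.commute)
    ultimately show "a \<in> A + B" using bc(1) by (auto intro: set_plus_intro)
  qed
qed

text \<open>Given a point of \<open>A'\<close>, its coordinates outside \<open>X\<close> may be replaced by those of a point of \<open>B\<close> without
  leaving \<open>A'\<close>, and the resulting point lies in \<open>A' \<inter> B\<close>.\<close>
lemma cylinder_subset_if_Int_subset:
  assumes A: "cylinder X A" and A': "cylinder X A'" and B: "cylinder Y B" and "X \<inter> Y = {}"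
    and "B \<noteq> {}" and "A' \<inter> B \<subseteq> A"
  shows "A' \<subseteq> A"
proof
  fix a assume "a \<in> A'"
  obtain b c where bc: "a = b + c" "Poly_Mapping.keys b \<subseteq> X" "Poly_Mapping.keys c \<inter> X = {}" by (rule split_exponent)
  obtain d where "d \<in> B" using \<open>B \<noteq> {}\<close> by auto
  obtain d1 d2 where d: "d = d1 + d2" "Poly_Mapping.keys d1 \<subseteq> X" "Poly_Mapping.keys d2 \<inter> X = {}" by (rule split_exponent)
  have "b \<in> A'" using cylinder_cancel[OF A', of b c] \<open>a \<in> A'\<close> bc by simp
  moreover have "d2 \<in> B"
    using cylinder_cancel[OF B, of d2 d1] \<open>d \<in> B\<close> d assms(4) by (auto simp: add.commute)
  ultimately have "b + d2 \<in> A' \<inter> B"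
    using cylinder_add[OF A', of b d2] cylinder_add[OF B, of d2 b] by (simp add: add.commute)
  then have "b \<in> A" using assms(6) cylinder_cancel[OF A, of b d2] d(3) by auto
  then show "a \<in> A" using cylinder_add[OF A] bc(1) by simp
qed

text \<open>Two multipliers that work for \<open>U\<close> and for \<open>V\<close> are replaced by their product.\<close>
lemma power_hull_n_fold_Int:
  assumes "\<And>k. n_fold W k = n_fold U k \<inter> n_fold V k"
  shows "power_hull (n_fold W n) = power_hull (n_fold U n) \<inter> power_hull (n_fold V n)"
proof
  show "power_hull (n_fold W n) \<subseteq> power_hull (n_fold U n) \<inter> power_hull (n_fold V n)"
    by (simp add: assms power_hull_mono)
  show "power_hull (n_fold U n) \<inter> power_hull (n_fold V n) \<subseteq> power_hull (n_fold W n)"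
  proof
    fix a assume a: "a \<in> power_hull (n_fold U n) \<inter> power_hull (n_fold V n)"
    obtain k where k: "k \<ge> 1" "nscale k a \<in> n_fold U (n * k)"
      using a by (auto elim: power_hullE simp: n_fold_n_fold)
    obtain l where l: "l \<ge> 1" "nscale l a \<in> n_fold V (n * l)"
      using a by (auto elim: power_hullE simp: n_fold_n_fold)
    have "nscale (k * l) a \<in> n_fold U (n * (k * l))"
      using nscale_n_fold[OF k(2), of l] by (simp add: ac_simps flip: nscale_mult)
    moreover have "nscale (k * l) a \<in> n_fold V (n * (k * l))"
      using nscale_n_fold[OF l(2), of k] by (simp add: ac_simps flip: nscale_mult)
    ultimately have "nscale (k * l) a \<in> n_fold (n_fold W n) (k * l)"
      unfolding n_fold_n_fold unfolding assms by blast
    then show "a \<in> power_hull (n_fold W n)" using k l by (intro power_hullI[of "k * l"]) auto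
  qed
qed

lemma generated_by_monomials_inE:
  assumes "generated_by_monomials_in I X"
  obtains U where "I = monomial_span (n_fold U 1)" "\<And>u. u \<in> U \<Longrightarrow> Poly_Mapping.keys u \<subseteq> X"
proof -
  obtain G where G: "G \<subseteq> monomials_in X" "I = ideal.span G"
    using assms by (auto simp: generated_by_monomials_in_def)
  define U where "U = {u. Poly_Mapping.keys u \<subseteq> X \<and> Poly_Mapping.single u 1 \<in> G}"
  have "G = (\<lambda>u. Poly_Mapping.single u 1) ` U"
  proof
    show "G \<subseteq> (\<lambda>u. Poly_Mapping.single u 1) ` U"
    proof
      fix x assume "x \<in> G"
      moreover from this obtain u where "x = Poly_Mapping.single u 1" "Poly_Mapping.keys u \<subseteq> X"
        using G(1) unfolding monomials_in_def by blast
      ultimately show "x \<in> (\<lambda>u. Poly_Mapping.single u 1) ` U" unfolding U_def by blast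
    qed
  qed (auto simp: U_def)
  then have "I = monomial_span (n_fold U 1)" using G(2) span_monomials[of U] by simp
  then show ?thesis by (rule that) (simp add: U_def)
qed

theorem proposition3p1:
  fixes I\<^sub>1 I\<^sub>2 :: "('v::finite, 'k::field) mpoly set"
  assumes "generated_by_monomials_in_disjoint_variables I\<^sub>1 I\<^sub>2"
  shows "ideal_prod I\<^sub>1 I\<^sub>2 = I\<^sub>1 \<inter> I\<^sub>2
    \<and> ideal_prod (integral_closure I\<^sub>1) (integral_closure I\<^sub>2)
        \<subseteq> integral_closure (ideal_prod I\<^sub>1 I\<^sub>2)
    \<and> (\<forall>n\<ge>1. integral_closure (ideal_pow (ideal_prod I\<^sub>1 I\<^sub>2) n)
        = ideal_prod (integral_closure (ideal_pow I\<^sub>1 n)) (integral_closure (ideal_pow I\<^sub>2 n)))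
    \<and> (I\<^sub>1 \<noteq> {0} \<longrightarrow> I\<^sub>2 \<noteq> {0} \<longrightarrow>
        (normal_ideal (ideal_prod I\<^sub>1 I\<^sub>2) \<longleftrightarrow> normal_ideal I\<^sub>1 \<and> normal_ideal I\<^sub>2))"
proof -
  obtain X\<^sub>1 X\<^sub>2 where disj: "X\<^sub>1 \<inter> X\<^sub>2 = {}"
    and gen: "generated_by_monomials_in I\<^sub>1 X\<^sub>1" "generated_by_monomials_in I\<^sub>2 X\<^sub>2"
    using assms by (auto simp: generated_by_monomials_in_disjoint_variables_def)
  obtain U\<^sub>1 where I1: "I\<^sub>1 = monomial_span (n_fold U\<^sub>1 1)" and U1: "\<And>u. u \<in> U\<^sub>1 \<Longrightarrow> Poly_Mapping.keys u \<subseteq> X\<^sub>1"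
    using generated_by_monomials_inE[OF gen(1)] by blast
  obtain U\<^sub>2 where I2: "I\<^sub>2 = monomial_span (n_fold U\<^sub>2 1)" and U2: "\<And>u. u \<in> U\<^sub>2 \<Longrightarrow> Poly_Mapping.keys u \<subseteq> X\<^sub>2"
    using generated_by_monomials_inE[OF gen(2)] by blast
  define W where "W = U\<^sub>1 + U\<^sub>2"
  have prod: "ideal_prod I\<^sub>1 I\<^sub>2 = monomial_span (n_fold W 1)"
    unfolding I1 I2 W_def n_fold_plus by (rule ideal_prod_monomial_span[OF upward_closed_n_fold])
  have cyl1: "cylinder X\<^sub>1 (n_fold U\<^sub>1 n)" and cyl2: "cylinder X\<^sub>2 (n_fold U\<^sub>2 n)" for n
    using U1 U2 by (auto intro!: cylinder_n_fold)
  have hull1: "cylinder X\<^sub>1 (power_hull (n_fold U\<^sub>1 n))"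
    and hull2: "cylinder X\<^sub>2 (power_hull (n_fold U\<^sub>2 n))" for n
    by (auto intro!: cylinder_power_hull simp: n_fold_n_fold cyl1 cyl2)
  have W: "n_fold W n = n_fold U\<^sub>1 n \<inter> n_fold U\<^sub>2 n" for n
    unfolding W_def n_fold_plus by (rule cylinder_plus_eq_Int[OF cyl1 cyl2 disj])
  have hullW: "power_hull (n_fold W n) = power_hull (n_fold U\<^sub>1 n) \<inter> power_hull (n_fold U\<^sub>2 n)" for n
    by (rule power_hull_n_fold_Int[OF W])
  have a: "ideal_prod I\<^sub>1 I\<^sub>2 = I\<^sub>1 \<inter> I\<^sub>2"
    unfolding prod W by (auto simp: I1 I2 monomial_span_def)
  have c: "integral_closure (ideal_pow (ideal_prod I\<^sub>1 I\<^sub>2) n)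
        = ideal_prod (integral_closure (ideal_pow I\<^sub>1 n)) (integral_closure (ideal_pow I\<^sub>2 n))" for n
    unfolding prod unfolding I1 I2 integral_closure_ideal_pow_monomial_span hullW
    by (simp only: ideal_prod_monomial_span[OF upward_closed_power_hull]
        cylinder_plus_eq_Int[OF hull1 hull2 disj])
  have pow1: "ideal_pow (monomial_span (n_fold U 1) :: ('v, 'k) mpoly set) 1 = monomial_span (n_fold U 1)" for U
    by (rule ideal_pow_monomial_span)
  have b: "ideal_prod (integral_closure I\<^sub>1) (integral_closure I\<^sub>2) \<subseteq> integral_closure (ideal_prod I\<^sub>1 I\<^sub>2)"
    using c[of 1] unfolding prod unfolding I1 I2 pow1 by simp
  have d: "normal_ideal (ideal_prod I\<^sub>1 I\<^sub>2) \<longleftrightarrow> normal_ideal I\<^sub>1 \<and> normal_ideal I\<^sub>2"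
    if "I\<^sub>1 \<noteq> {0}" "I\<^sub>2 \<noteq> {0}"
  proof -
    have "U \<noteq> {}" if "monomial_span (n_fold U 1) \<noteq> {0 :: ('v, 'k) mpoly}" for U :: "('v \<Rightarrow>\<^sub>0 nat) set"
      using that by (auto simp: monomial_span_def)
    then have ne: "U\<^sub>1 \<noteq> {}" "U\<^sub>2 \<noteq> {}" using that unfolding I1 I2 by blast+
    have ne_fold: "n_fold U n \<noteq> {}" if "U \<noteq> {}" for U :: "('v \<Rightarrow>\<^sub>0 nat) set" and n
      using that by (induction n) (auto simp: set_plus_def)
    have iff: "n_fold W n = power_hull (n_fold W n)
      \<longleftrightarrow> n_fold U\<^sub>1 n = power_hull (n_fold U\<^sub>1 n) \<and> n_fold U\<^sub>2 n = power_hull (n_fold U\<^sub>2 n)" for n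
    proof
      assume eq: "n_fold W n = power_hull (n_fold W n)"
      have sub: "n_fold U n \<subseteq> power_hull (n_fold U n)" for U :: "('v \<Rightarrow>\<^sub>0 nat) set"
        using n_fold_1_subset_power_hull[of "n_fold U n"] by (simp only: n_fold_n_fold mult_1_right)
      have "power_hull (n_fold U\<^sub>1 n) \<inter> n_fold U\<^sub>2 n \<subseteq> n_fold U\<^sub>1 n"
        using eq sub[of U\<^sub>2] unfolding hullW unfolding W by blast
      then have "power_hull (n_fold U\<^sub>1 n) \<subseteq> n_fold U\<^sub>1 n"
        by (rule cylinder_subset_if_Int_subset[OF cyl1 hull1 cyl2 disj ne_fold[OF ne(2)]])
      moreover have "power_hull (n_fold U\<^sub>2 n) \<inter> n_fold U\<^sub>1 n \<subseteq> n_fold U\<^sub>2 n"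
        using eq sub[of U\<^sub>1] unfolding hullW unfolding W by blast
      then have "power_hull (n_fold U\<^sub>2 n) \<subseteq> n_fold U\<^sub>2 n"
        using disj by (intro cylinder_subset_if_Int_subset[OF cyl2 hull2 cyl1 _ ne_fold[OF ne(1)]]) auto
      ultimately show "n_fold U\<^sub>1 n = power_hull (n_fold U\<^sub>1 n) \<and> n_fold U\<^sub>2 n = power_hull (n_fold U\<^sub>2 n)"
        using sub by blast
    next
      assume "n_fold U\<^sub>1 n = power_hull (n_fold U\<^sub>1 n) \<and> n_fold U\<^sub>2 n = power_hull (n_fold U\<^sub>2 n)"
      then show "n_fold W n = power_hull (n_fold W n)" unfolding hullW unfolding W by simp
    qed
    show ?thesis
      unfolding prod unfolding I1 I2 normal_monomial_ideal_iff iff by blast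
  qed
  show ?thesis by (intro conjI allI impI a b c d) assumption+
qed

end
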